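(* Let $a,b$ be real numbers with $b>a$, let $\alpha>0$ and let $x>0$. Then the improper integral $$\int_0^\infty\left[\frac{b-a}{e^{(b-a)t}-1}-\frac1t+b\right]\frac{e^{-tx}}{t}\,dt$$ converges if and only if $a+b=0$. Moreover, $$\int_0^\infty\left(\frac{\alpha}{e^{\alpha t}-1}-\frac1t+\frac{\alpha}{2}\right)\frac{e^{-tx}}{t}\,dt=\alpha\ln\Gamma\left(\frac{x}{\alpha}\right)-\left(x-\frac{\alpha}{2}\right)\ln\frac{x}{\alpha}+x-\frac{\alpha}{2}\ln(2\pi).$$
   Context: $\Gamma(x)=\int_0^\infty t^{x-1}e^{-t}\,dt$ ($x>0$) is Euler's gamma function. The integrals over $(0,\infty)$ are improper at both endpoints $0$ and $\infty$. *)

theory Defs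
  imports "HOL-Analysis.Analysis"
begin

text \<open>
  The improper integral over \<open>(0, \<infinity>)\<close>, improper at both endpoints: the limits \<open>c \<rightarrow> 0+\<close> and
  \<open>d \<rightarrow> \<infinity>\<close> of the integral over \<open>[c, d]\<close> are taken independently of each other (hence the product
  filter).  Absolute convergence is not required.  On the compact intervals the gauge integral is
  used, which for continuous integrands is the Riemann integral.
\<close>

definition has_improper_integral :: "(real \<Rightarrow> real) \<Rightarrow> real \<Rightarrow> bool"
    (infixr "has'_improper'_integral" 46) where
  "f has_improper_integral I \<longleftrightarrow>
     (\<forall>c d. 0 < c \<and> c \<le> d \<longrightarrow> f integrable_on {c..d}) \<and>
     ((\<lambda>(c, d). integral {c..d} f) \<longlongrightarrow> I) (at_right 0 \<times>\<^sub>F at_top)"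

definition improper_integral_converges :: "(real \<Rightarrow> real) \<Rightarrow> bool" where
  "improper_integral_converges f \<longleftrightarrow> (\<exists>I. f has_improper_integral I)"

end

theory Submission
  imports Defs "HOL-Real_Asymp.Real_Asymp"
begin

text \<open>
  Write \<open>K t = (1 / (exp t - 1) - 1 / t + 1/2) / t\<close>, let \<open>F x\<close> be the integral of
  \<open>K t * exp (- (t * x))\<close> over \<open>t > 0\<close>, and let \<open>G x\<close> be the error of Stirling's approximation to
  \<open>ln (Gamma x)\<close>. The case \<open>\<alpha> = 1\<close> of the formula is Binet's first formula \<open>F = G\<close>, and the case of
  general \<open>\<alpha>\<close> follows by the substitution \<open>u = \<alpha> * t\<close>.

  The source of everything about the kernel is the identity
  \[(1 - e^{-t}) K(t) = \int_0^1 (1/2 - s) e^{-ts}\,ds\]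
  (lemma \<open>has_integral_binet_kernel_numerator\<close>). It shows at once that \<open>K\<close> is bounded, so that \<open>F\<close>
  is an absolutely convergent integral and tends to \<open>0\<close> at infinity. Multiplying it by
  \<open>exp (- (t * x))\<close> and integrating over \<open>t\<close> gives, by Fubini,
  \[F(x) - F(x+1) = \int_0^1 \frac{1/2 - s}{x + s}\,ds = (x + 1/2) \ln\frac{x+1}{x} - 1,\]
  and by the functional equation of the Gamma function \<open>G x - G (x + 1)\<close> has the same value
  (\<open>binet_integral_diff\<close>, \<open>stirling_error_diff\<close>). Hence \<open>D = G - F\<close> is \<open>1\<close>-periodic. Its behaviour at
  infinity is that of \<open>G\<close>: Gauss's limit formula for the Gamma function makes \<open>G (x + n) - G n\<close> tend to
  \<open>0\<close>, so \<open>D\<close> is a constant \<open>k\<close>, and Legendre's duplication formula makes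
  \<open>G x + G (x + 1/2) - G (2 * x)\<close> tend to \<open>0\<close>, so \<open>k + k - k = 0\<close>. It is this last step
  that pins down the constant \<open>ln (2 * pi) / 2\<close>.

  For the convergence criterion put \<open>\<alpha> = b - a\<close>. The integrand exceeds that of the formula by
  \<open>(a + b) / 2 * exp (- (t * x)) / t\<close>, whose integral diverges at \<open>0\<close> unless \<open>a + b = 0\<close>.
\<close>

section \<open>Improper integrals over the positive half-line\<close>

lemma eventually_improper_endpoints:
  "eventually (\<lambda>p. (0 < fst p \<and> fst p < 1) \<and> 1 < snd p) (at_right (0::real) \<times>\<^sub>F (at_top :: real filter))"
  using eventually_prodI[OF eventually_at_right_real[of 0 1] eventually_gt_at_top[of "1::real"]]
  by (auto elim!: eventually_mono)

text \<open>
  For an absolutely integrable function the two limits can be taken separately once the integral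
  is split at \<open>1\<close>, and each of them is a case of dominated convergence.
\<close>

lemma has_improper_integral_of_set_integrable:
  assumes "set_integrable lborel {0<..} f"
  shows "f has_improper_integral (LINT t:{0<..}|lborel. f t)"
proof -
  have sub: "set_integrable lborel A f" if "A \<subseteq> {0<..}" "A \<in> sets borel" for A
    using set_integrable_subset[OF assms _ that(1)] that(2) by simp
  have int: "f integrable_on {c..d}" "(LINT t:{c..d}|lborel. f t) = integral {c..d} f" if "c > 0" for c d
    using set_borel_integral_eq_integral[OF sub[of "{c..d}"]] that by force+
  have "((\<lambda>c. LINT t:{c..1}|lborel. f t) \<longlongrightarrow> (LINT t:{0<..1}|lborel. f t)) (at_right 0)"
    by (rule tendsto_set_lebesgue_integral_at_right) (auto intro!: sub)
  moreover have "((\<lambda>d. LINT t:{1..d}|lborel. f t) \<longlongrightarrow> (LINT t:{1..}|lborel. f t)) at_top"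
    by (rule tendsto_set_lebesgue_integral_at_top) (auto intro!: sub)
  ultimately have lim: "((\<lambda>(c,d). (LINT t:{c..1}|lborel. f t) + (LINT t:{1..d}|lborel. f t)) \<longlongrightarrow>
       (LINT t:{0<..1}|lborel. f t) + (LINT t:{1..}|lborel. f t)) (at_right 0 \<times>\<^sub>F at_top)"
    unfolding case_prod_unfold
    by (intro tendsto_add filterlim_compose[OF _ filterlim_fst] filterlim_compose[OF _ filterlim_snd])
  have "(LINT t:{0<..1} \<union> {1<..}|lborel. f t) = (LINT t:{0<..1}|lborel. f t) + (LINT t:{1<..}|lborel. f t)"
    by (rule set_integral_Un) (auto intro!: sub)
  moreover have "(LINT t:{1<..}|lborel. f t) = (LINT t:{1..}|lborel. f t)"
    unfolding set_lebesgue_integral_def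
  proof (rule integral_cong_AE)
    show "(\<lambda>t. indicator {1<..} t *\<^sub>R f t) \<in> borel_measurable lborel"
      using sub[of "{1<..}"] unfolding set_integrable_def by (intro borel_measurable_integrable) auto
    have "{1..} \<subseteq> {0::real<..}" by auto
    thus "(\<lambda>t. indicator {1..} t *\<^sub>R f t) \<in> borel_measurable lborel"
      using sub[of "{1..}"] unfolding set_integrable_def by (intro borel_measurable_integrable) auto
    show "AE t in lborel. indicator {1<..} t *\<^sub>R f t = indicator {1..} t *\<^sub>R f t"
      using AE_lborel_singleton[of "1::real"] by eventually_elim (auto simp: indicator_def)
  qed
  moreover have "{0<..1} \<union> {1<..} = {0::real<..}" by auto
  ultimately have val: "(LINT t:{0<..1}|lborel. f t) + (LINT t:{1..}|lborel. f t) = (LINT t:{0<..}|lborel. f t)"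
    by simp
  have "((\<lambda>(c,d). integral {c..d} f) \<longlongrightarrow> (LINT t:{0<..}|lborel. f t)) (at_right 0 \<times>\<^sub>F at_top)"
    using lim unfolding val
  proof (rule Lim_transform_eventually)
    show "\<forall>\<^sub>F p in at_right 0 \<times>\<^sub>F at_top.
       (case p of (c, d) \<Rightarrow> (LINT t:{c..1}|lborel. f t) + (LINT t:{1..d}|lborel. f t)) =
       (case p of (c, d) \<Rightarrow> integral {c..d} f)"
      using eventually_improper_endpoints
    proof eventually_elim
      case (elim p)
      thus ?case
        using int Henstock_Kurzweil_Integration.integral_combine[of "fst p" 1 "snd p" f]
        by (simp add: case_prod_unfold)
    qed
  qed
  thus ?thesis unfolding has_improper_integral_def using int by auto
qed

lemma has_improper_integral_cmult:
  assumes "f has_improper_integral I"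
  shows "(\<lambda>t. k * f t) has_improper_integral (k * I)"
proof -
  have "((\<lambda>p. k * (case p of (c,d) \<Rightarrow> integral {c..d} f)) \<longlongrightarrow> k * I) (at_right 0 \<times>\<^sub>F at_top)"
    using assms unfolding has_improper_integral_def by (intro tendsto_mult_left) auto
  thus ?thesis using assms
    unfolding has_improper_integral_def
    by (auto simp: case_prod_unfold intro!: integrable_on_mult_right)
qed

lemma has_improper_integral_diff:
  assumes "f has_improper_integral I" "g has_improper_integral J"
  shows "(\<lambda>t. f t - g t) has_improper_integral (I - J)"
proof -
  have "((\<lambda>p. (case p of (c,d) \<Rightarrow> integral {c..d} f) - (case p of (c,d) \<Rightarrow> integral {c..d} g)) \<longlongrightarrow> I - J)
          (at_right 0 \<times>\<^sub>F at_top)"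
    using assms unfolding has_improper_integral_def by (intro tendsto_diff) auto
  moreover have "eventually (\<lambda>p. (case p of (c,d) \<Rightarrow> integral {c..d} f) - (case p of (c,d) \<Rightarrow> integral {c..d} g)
        = (case p of (c,d) \<Rightarrow> integral {c..d} (\<lambda>t. f t - g t))) (at_right 0 \<times>\<^sub>F at_top)"
    using eventually_improper_endpoints
  proof eventually_elim
    case (elim p)
    thus ?case
      using assms unfolding has_improper_integral_def
      by (simp add: case_prod_unfold Henstock_Kurzweil_Integration.integral_diff)
  qed
  ultimately have "((\<lambda>(c,d). integral {c..d} (\<lambda>t. f t - g t)) \<longlongrightarrow> I - J) (at_right 0 \<times>\<^sub>F at_top)"
    by (rule Lim_transform_eventually)
  thus ?thesis using assms unfolding has_improper_integral_def
    by (auto intro!: Henstock_Kurzweil_Integration.integrable_diff)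
qed

text \<open>
  The divergence is at \<open>0\<close>: there \<open>exp (- (t * x)) / t\<close> dominates a positive multiple of \<open>1 / t\<close>.
\<close>

lemma not_improper_integral_converges_exp_over_t:
  assumes x: "x > 0"
  shows "\<not> improper_integral_converges (\<lambda>t. exp (-(t*x)) / t)"
proof
  let ?f = "\<lambda>t. exp (-(t*x)) / t"
  assume "improper_integral_converges ?f"
  then obtain I where int: "\<And>c d. 0 < c \<Longrightarrow> c \<le> d \<Longrightarrow> ?f integrable_on {c..d}"
    and lim: "((\<lambda>(c, d). integral {c..d} ?f) \<longlongrightarrow> I) (at_right 0 \<times>\<^sub>F at_top)"
    unfolding improper_integral_converges_def has_improper_integral_def by blast
  have "LIM p at_right 0 \<times>\<^sub>F at_top. exp (-x) * - ln (fst p :: real) :> at_top"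
  proof (rule filterlim_compose[OF _ filterlim_fst])
    show "LIM c at_right 0. exp (-x) * - ln (c :: real) :> at_top" by real_asymp
  qed
  moreover have "eventually (\<lambda>p. exp (-x) * - ln (fst p) \<le> (\<lambda>(c, d). integral {c..d} ?f) p)
      (at_right 0 \<times>\<^sub>F at_top)"
    using eventually_improper_endpoints
  proof eventually_elim
    case (elim p)
    obtain c d where p: "p = (c,d)" by (cases p)
    with elim have cd: "0 < c" "c < 1" "1 < d" by auto
    have "((\<lambda>t. exp (-x) * (1 / t)) has_integral exp (-x) * (ln 1 - ln c)) {c..1}"
      by (intro has_integral_mult_right fundamental_theorem_of_calculus)
         (use cd in \<open>auto intro!: derivative_eq_intros
            simp: has_real_derivative_iff_has_vector_derivative[symmetric]\<close>)
    hence "exp (-x) * (ln 1 - ln c) \<le> integral {c..1} ?f"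
    proof (rule has_integral_le[OF _ integrable_integral[OF int]])
      fix t assume t: "t \<in> {c..1}"
      have "exp (-x) \<le> exp (-(t*x))" using t x by simp
      thus "exp (-x) * (1 / t) \<le> ?f t" using t cd by (simp add: field_simps)
    qed (use cd in auto)
    also have "\<dots> \<le> integral {c..d} ?f"
      by (rule integral_subset_le) (use cd in \<open>auto intro!: int\<close>)
    finally show ?case by (simp add: p)
  qed
  ultimately have "LIM p at_right 0 \<times>\<^sub>F at_top. (\<lambda>(c, d). integral {c..d} ?f) p :> at_top"
    by (rule filterlim_at_top_mono)
  moreover have "at_right (0::real) \<times>\<^sub>F (at_top :: real filter) \<noteq> bot"
    by (simp add: prod_filter_eq_bot)
  ultimately show False
    using lim not_tendsto_and_filterlim_at_infinity filterlim_at_top_imp_at_infinity by blast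
qed

section \<open>Binet's kernel and integral\<close>

definition binet_kernel :: "real \<Rightarrow> real" where
  "binet_kernel t = (1 / (exp t - 1) - 1 / t + 1 / 2) / t"

text \<open>
  The value of the integral is \<open>(1 - exp (-t)) / (2 * t) - (1 - exp (-t)) / t\<^sup>2 + exp (-t) / t\<close>, and
  \<open>(1 - exp (-t)) / (exp t - 1) = exp (-t)\<close>.
\<close>

lemma has_integral_binet_kernel_numerator:
  assumes "t > 0"
  shows "((\<lambda>s. (1/2 - s) * exp (- (t * s))) has_integral (1 - exp (-t)) * binet_kernel t) {0..1}"
proof -
  define A where "A = (\<lambda>s::real. exp (- (t * s)) * ((s - 1/2) / t + 1 / t^2))"
  have "((\<lambda>s. (1/2 - s) * exp (- (t * s))) has_integral A 1 - A 0) {0..1}"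
  proof (rule fundamental_theorem_of_calculus)
    fix s :: real
    show "(A has_vector_derivative (1/2 - s) * exp (- (t * s))) (at s within {0..1})"
      unfolding A_def using assms
      by (auto intro!: derivative_eq_intros simp: has_real_derivative_iff_has_vector_derivative[symmetric]
            power2_eq_square field_simps)
  qed auto
  moreover have "A 1 - A 0 = (1 - exp (-t)) * binet_kernel t"
  proof -
    have "exp t \<noteq> 1" using assms by simp
    thus ?thesis using assms unfolding A_def binet_kernel_def
      by (simp add: field_simps power2_eq_square exp_minus)
  qed
  ultimately show ?thesis by simp
qed

text \<open>
  Since \<open>1/2 - s\<close> has integral \<open>0\<close> over \<open>[0, 1]\<close>, the factor \<open>exp (- (t * s))\<close> in the preceding
  integral can be replaced by \<open>exp (- (t * s)) - 1\<close>. This is at most \<open>1 - exp (-t)\<close> in absolute value,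
  the very factor in front of the kernel.
\<close>

lemma abs_binet_kernel_le:
  assumes "t > 0"
  shows "\<bar>binet_kernel t\<bar> \<le> 1/2"
proof -
  have "((\<lambda>s::real. 1/2 - s) has_integral (\<lambda>s. s/2 - s^2/2) 1 - (\<lambda>s. s/2 - s^2/2) 0) {0..1}"
    by (rule fundamental_theorem_of_calculus)
       (auto intro!: derivative_eq_intros simp: has_real_derivative_iff_has_vector_derivative[symmetric])
  hence "((\<lambda>s::real. 1/2 - s) has_integral 0) {0..1}" by simp
  from has_integral_diff[OF has_integral_binet_kernel_numerator[OF assms] this]
  have I: "((\<lambda>s. (1/2 - s) * (exp (- (t * s)) - 1)) has_integral (1 - exp (-t)) * binet_kernel t) (cbox 0 1)"
    by (simp add: algebra_simps)
  have "norm ((1 - exp (-t)) * binet_kernel t) \<le> (1/2 * (1 - exp (-t))) * measure lborel (cbox 0 (1::real))"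
  proof (rule has_integral_bound[OF _ I])
    fix s :: real assume s: "s \<in> cbox 0 1"
    have "\<bar>exp (- (t * s)) - 1\<bar> \<le> 1 - exp (-t)"
      using s assms mult_left_mono[of s 1 t] by auto
    moreover have "\<bar>1/2 - s\<bar> \<le> 1/2" using s unfolding abs_le_iff by auto
    ultimately show "norm ((1/2 - s) * (exp (- (t * s)) - 1)) \<le> 1/2 * (1 - exp (-t))"
      unfolding real_norm_def abs_mult by (intro mult_mono) auto
  qed (use assms in auto)
  hence "(1 - exp (-t)) * \<bar>binet_kernel t\<bar> \<le> (1 - exp (-t)) * (1/2)"
    using assms by (simp add: abs_mult)
  thus ?thesis using assms by (subst (asm) mult_le_cancel_left_pos) auto
qed

lemma
  assumes "x > (0::real)"
  shows set_integrable_exp_minus: "set_integrable lborel {0<..} (\<lambda>t. exp (-(t*x)))"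
    and set_integral_exp_minus: "(LINT t:{0<..}|lborel. exp (-(t*x))) = 1/x"
proof -
  have "((\<lambda>t. exp (-x*t)) has_integral exp (-x*0)/x) {0..}"
    by (rule has_integral_exp_minus_to_infinity) fact
  hence "((\<lambda>t. exp (-(t*x))) has_integral 1/x) {0..}" by (simp add: mult.commute)
  moreover have "negligible {t \<in> {0<..} - {0..}. exp (-(t*x)) \<noteq> 0}"
    by (rule negligible_subset[of "{}"]) auto
  moreover have "negligible {t \<in> {0..} - {0<..}. exp (-(t*x)) \<noteq> 0}"
    by (rule negligible_subset[of "{0}"]) auto
  ultimately have hi: "((\<lambda>t. exp (-(t*x))) has_integral 1/x) {0<..}"
    using has_integral_spike_set_eq[of "{0<..}" "{0..}" "\<lambda>t. exp (-(t*x))"] by blast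
  hence "set_integrable lebesgue {0<..} (\<lambda>t. exp (-(t*x)))"
    by (intro nonnegative_absolutely_integrable_1) auto
  thus si: "set_integrable lborel {0<..} (\<lambda>t. exp (-(t*x)))"
    unfolding set_integrable_def by (subst (asm) integrable_completion) auto
  show "(LINT t:{0<..}|lborel. exp (-(t*x))) = 1/x"
    using set_borel_integral_eq_integral(2)[OF si] hi by (simp add: integral_unique)
qed

definition binet_integral :: "real \<Rightarrow> real" where
  "binet_integral x = (LINT t:{0<..}|lborel. binet_kernel t * exp (-(t*x)))"

lemma set_integrable_binet:
  assumes "x > 0"
  shows "set_integrable lborel {0<..} (\<lambda>t. binet_kernel t * exp (-(t*x)))"
proof (rule set_integrable_bound[OF set_integrable_exp_minus[OF assms]])
  show "set_borel_measurable lborel {0<..} (\<lambda>t. binet_kernel t * exp (-(t*x)))"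
    unfolding set_borel_measurable_def binet_kernel_def by measurable
  show "AE t in lborel. t \<in> {0<..} \<longrightarrow>
          norm (binet_kernel t * exp (-(t*x))) \<le> norm (exp (-(t*x)))"
  proof (intro AE_I2 impI)
    fix t :: real assume "t \<in> {0<..}"
    hence "\<bar>binet_kernel t\<bar> \<le> 1" using abs_binet_kernel_le[of t] by simp
    thus "norm (binet_kernel t * exp (-(t*x))) \<le> norm (exp (-(t*x)))"
      by (simp add: abs_mult)
  qed
qed

lemma abs_binet_integral_le:
  assumes "x > 0"
  shows "\<bar>binet_integral x\<bar> \<le> 1 / x"
proof -
  have "\<bar>binet_integral x\<bar> \<le> (LINT t:{0<..}|lborel. exp (-(t*x)))"
    unfolding binet_integral_def set_lebesgue_integral_def
  proof (rule integral_abs_bound[THEN order_trans], rule integral_mono)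
    fix t :: real
    have "t > 0 \<Longrightarrow> \<bar>binet_kernel t\<bar> \<le> 1" using abs_binet_kernel_le[of t] by simp
    thus "\<bar>indicator {0<..} t *\<^sub>R (binet_kernel t * exp (-(t*x)))\<bar> \<le> indicator {0<..} t *\<^sub>R exp (-(t*x))"
      by (simp add: abs_mult indicator_def)
  qed (use set_integrable_binet[OF assms] set_integrable_exp_minus[OF assms] in \<open>auto simp: set_integrable_def\<close>)
  thus ?thesis using set_integral_exp_minus[OF assms] by simp
qed

lemma binet_integral_tendsto_0: "(binet_integral \<longlongrightarrow> 0) at_top"
proof (rule Lim_null_comparison)
  show "eventually (\<lambda>x. norm (binet_integral x) \<le> 1 / x) at_top"
    using eventually_gt_at_top[of 0] by eventually_elim (simp add: abs_binet_integral_le del: divide_const_simps)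
qed real_asymp

text \<open>
  The difference brings in the factor \<open>1 - exp (-t)\<close>, which turns the kernel into its integral
  representation over \<open>[0, 1]\<close>. The resulting double integral becomes elementary once the order of
  integration is exchanged.
\<close>

lemma binet_integral_diff:
  assumes x: "x > 0"
  shows "binet_integral x - binet_integral (x + 1) = (x + 1/2) * ln ((x + 1) / x) - 1"
proof -
  define f where "f = (\<lambda>s t::real. (indicator {0..1} s * indicator {0<..} t) * ((1/2 - s) * exp (-(t*(x+s)))))"
  \<comment> \<open>an integrable majorant of \<open>f\<close> in product form\<close>
  define g where "g = (\<lambda>(s,t::real). indicator {0..1::real} s * (indicator {0<..} t * exp (-(t*x))))"
  have g: "integrable (lborel \<Otimes>\<^sub>M lborel) g"
  proof (rule lborel_pair.Fubini_integrable)
    show "g \<in> borel_measurable (lborel \<Otimes>\<^sub>M lborel)" unfolding g_def by measurable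
    show "integrable lborel (\<lambda>s. \<integral>t. norm (g (s,t)) \<partial>lborel)"
      using set_integral_exp_minus[OF x]
      by (simp add: g_def abs_mult set_lebesgue_integral_def)
    show "AE s in lborel. integrable lborel (\<lambda>t. g (s,t))"
      using set_integrable_exp_minus[OF x] by (simp add: g_def set_integrable_def)
  qed
  have f: "integrable (lborel \<Otimes>\<^sub>M lborel) (case_prod f)"
  proof (rule Bochner_Integration.integrable_bound[OF g])
    show "case_prod f \<in> borel_measurable (lborel \<Otimes>\<^sub>M lborel)" unfolding f_def by measurable
    show "AE p in lborel \<Otimes>\<^sub>M lborel. norm (case_prod f p) \<le> norm (g p)"
    proof (intro AE_I2)
      fix p :: "real \<times> real"
      obtain s t where p: "p = (s,t)" by (cases p)
      have "\<bar>1/2 - s\<bar> * exp (-(t*(x+s))) \<le> 1 * exp (-(t*x))" if "t > 0" "s \<ge> 0" "s \<le> 1"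
        using that by (intro mult_mono) (auto simp: algebra_simps)
      thus "norm (case_prod f p) \<le> norm (g p)"
        by (simp add: p f_def g_def abs_mult indicator_def)
    qed
  qed
  have "binet_integral x - binet_integral (x+1) =
          (LINT t:{0<..}|lborel. binet_kernel t * exp (-(t*x)) - binet_kernel t * exp (-(t*(x+1))))"
    unfolding binet_integral_def
    by (rule set_integral_diff(2)[symmetric]) (use x in \<open>auto intro!: set_integrable_binet\<close>)
  also have "\<dots> = (\<integral>t. (\<integral>s. f s t \<partial>lborel) \<partial>lborel)"
    unfolding set_lebesgue_integral_def
  proof (rule Bochner_Integration.integral_cong[OF refl])
    fix t :: real
    show "indicator {0<..} t *\<^sub>R (binet_kernel t * exp (-(t*x)) - binet_kernel t * exp (-(t*(x+1)))) =
            (\<integral>s. f s t \<partial>lborel)"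
    proof (cases "t > 0")
      case True
      have "set_integrable lborel {0..1} (\<lambda>s. (1/2 - s) * exp (- (t * s)))"
        by (rule borel_integrable_atLeastAtMost') (auto intro!: continuous_intros)
      from set_borel_integral_eq_integral(2)[OF this]
      have "(LINT s:{0..1}|lborel. (1/2 - s) * exp (- (t * s))) = (1 - exp (-t)) * binet_kernel t"
        using has_integral_binet_kernel_numerator[OF True] by (simp add: integral_unique)
      moreover have "(\<integral>s. f s t \<partial>lborel) =
          (\<integral>s. exp (-(t*x)) * (indicator {0..1} s *\<^sub>R ((1/2 - s) * exp (- (t * s)))) \<partial>lborel)"
      proof (intro Bochner_Integration.integral_cong refl)
        fix s :: real
        have "exp (-(t*(x+s))) = exp (-(t*x)) * exp (- (t * s))"
          by (simp add: distrib_left flip: exp_add)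
        thus "f s t = exp (-(t*x)) * (indicator {0..1} s *\<^sub>R ((1/2 - s) * exp (- (t * s))))"
          using True by (simp add: f_def)
      qed
      ultimately have "(\<integral>s. f s t \<partial>lborel) = exp (-(t*x)) * ((1 - exp (-t)) * binet_kernel t)"
        by (simp only: set_lebesgue_integral_def integral_mult_right_zero)
      also have "\<dots> = binet_kernel t * exp (-(t*x)) - binet_kernel t * exp (-(t*(x+1)))"
        by (simp add: distrib_left exp_diff exp_minus field_simps)
      finally show ?thesis using True by simp
    qed (simp add: f_def)
  qed
  also have "\<dots> = (\<integral>s. (\<integral>t. f s t \<partial>lborel) \<partial>lborel)"
    by (rule lborel_pair.Fubini_integral[OF f])
  also have "\<dots> = (LINT s:{0..1}|lborel. (1/2 - s) / (x + s))"
    unfolding set_lebesgue_integral_def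
  proof (rule Bochner_Integration.integral_cong[OF refl])
    fix s :: real
    show "(\<integral>t. f s t \<partial>lborel) = indicator {0..1} s *\<^sub>R ((1/2 - s) / (x + s))"
    proof (cases "s \<in> {0..1}")
      case True
      hence "(\<integral>t. f s t \<partial>lborel) = (\<integral>t. (1/2 - s) * (indicator {0<..} t *\<^sub>R exp (-(t*(x+s)))) \<partial>lborel)"
        by (intro Bochner_Integration.integral_cong) (auto simp: f_def)
      also have "\<dots> = (1/2 - s) * (1 / (x + s))"
        using set_integral_exp_minus[of "x+s"] x True by (simp add: set_lebesgue_integral_def)
      finally show ?thesis using True by simp
    qed (simp add: f_def)
  qed
  also have "\<dots> = integral {0..1} (\<lambda>s. (1/2 - s) / (x + s))"
    by (rule set_borel_integral_eq_integral(2)[OF borel_integrable_atLeastAtMost'])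
       (use x in \<open>auto intro!: continuous_intros\<close>)
  also have "\<dots> = (x + 1/2) * ln ((x + 1) / x) - 1"
  proof (rule integral_unique)
    have "((\<lambda>s. (1/2 - s) / (x + s)) has_integral
        (\<lambda>s. (x + 1/2) * ln (x + s) - s) 1 - (\<lambda>s. (x + 1/2) * ln (x + s) - s) 0) {0..1}"
      by (rule fundamental_theorem_of_calculus)
        (use x in \<open>auto intro!: derivative_eq_intros
           simp: has_real_derivative_iff_has_vector_derivative[symmetric] field_simps\<close>)
    thus "((\<lambda>s. (1/2 - s) / (x + s)) has_integral (x + 1/2) * ln ((x + 1) / x) - 1) {0..1}"
      using x by (simp add: ln_div algebra_simps)
  qed
  finally show ?thesis .
qed

section \<open>Binet's first formula\<close>

definition stirling_error :: "real \<Rightarrow> real" where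
  "stirling_error x = ln (Gamma x) - (x - 1/2) * ln x + x - ln (2 * pi) / 2"

lemma stirling_error_diff:
  assumes x: "x > 0"
  shows "stirling_error x - stirling_error (x + 1) = (x + 1/2) * ln ((x + 1) / x) - 1"
proof -
  have "Gamma (x + 1) = x * Gamma x" using x by (intro Gamma_plus1) auto
  hence "ln (Gamma (x + 1)) = ln x + ln (Gamma x)"
    using x Gamma_real_pos[OF x] by (simp add: ln_mult del: Gamma_real_pos)
  thus ?thesis using x by (simp add: stirling_error_def ln_div algebra_simps)
qed

text \<open>
  Gauss's limit formula says that \<open>Gamma (n + 1) * n powr x / Gamma (x + n + 1)\<close> tends to \<open>1\<close>. The
  elementary terms of the Stirling error cancel the logarithm of \<open>n powr x\<close> up to \<open>o(1)\<close>.
\<close>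

lemma stirling_error_shift_tendsto_0:
  assumes x: "x > 0"
  shows "(\<lambda>n. stirling_error (x + real (Suc n)) - stirling_error (real (Suc n))) \<longlonglongrightarrow> 0"
proof -
  have "(\<lambda>n. Gamma_series x n / Gamma x) \<longlonglongrightarrow> Gamma x / Gamma x"
    using Gamma_real_pos[OF x] by (intro tendsto_intros) auto
  hence "(\<lambda>n. Gamma_series x n / Gamma x) \<longlonglongrightarrow> 1"
    using Gamma_real_pos[OF x] by simp
  hence "(\<lambda>n. ln (Gamma_series x n / Gamma x)) \<longlonglongrightarrow> ln 1" by (intro tendsto_ln) auto
  moreover have "eventually (\<lambda>n. ln (Gamma_series x n / Gamma x) =
      ln (Gamma (real (Suc n))) + x * ln (real n) - ln (Gamma (x + real (Suc n)))) sequentially"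
    using eventually_gt_at_top[of 0]
  proof eventually_elim
    case (elim n)
    have "Gamma_series x n / Gamma x =
            Gamma (real (Suc n)) * exp (x * ln (real n)) / Gamma (x + real (Suc n))"
    proof -
      have "x \<notin> \<int>\<^sub>\<le>\<^sub>0" using x by auto
      hence "pochhammer x (Suc n) = Gamma (x + real (Suc n)) / Gamma x" by (rule pochhammer_Gamma)
      moreover have "Gamma (real (Suc n)) = fact n"
        using Gamma_fact[of n, where 'a = real] by (simp add: add.commute)
      ultimately show ?thesis using Gamma_real_pos[OF x] by (simp add: Gamma_series_def)
    qed
    thus ?case
      using x elim Gamma_real_pos[OF x] Gamma_real_pos[of "real (Suc n)"]
        Gamma_real_pos[of "x + real (Suc n)"]
      by (simp add: ln_div ln_mult del: Gamma_real_pos of_nat_Suc)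
  qed
  ultimately have "(\<lambda>n. ln (Gamma (real (Suc n))) + x * ln (real n) - ln (Gamma (x + real (Suc n)))) \<longlonglongrightarrow> 0"
    using Lim_transform_eventually by (force simp: tendsto_cong)
  moreover have "(\<lambda>n. x * ln (real n) - (x + real (Suc n) - 1/2) * ln (x + real (Suc n))
      + (real (Suc n) - 1/2) * ln (real (Suc n)) + x) \<longlonglongrightarrow> 0"
    using x by real_asymp
  ultimately have "(\<lambda>n. (x * ln (real n) - (x + real (Suc n) - 1/2) * ln (x + real (Suc n))
      + (real (Suc n) - 1/2) * ln (real (Suc n)) + x)
      - (ln (Gamma (real (Suc n))) + x * ln (real n) - ln (Gamma (x + real (Suc n))))) \<longlonglongrightarrow> 0 - 0"
    by (intro tendsto_diff)
  thus ?thesis by (simp add: stirling_error_def algebra_simps)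
qed

lemma ln_Gamma_duplication:
  assumes x: "x > (0::real)"
  shows "ln (Gamma x) + ln (Gamma (x + 1/2)) = (1 - 2*x) * ln 2 + ln pi / 2 + ln (Gamma (2*x))"
proof -
  have nonpos: "complex_of_real x \<notin> \<int>\<^sub>\<le>\<^sub>0" "complex_of_real (x + 1/2) \<notin> \<int>\<^sub>\<le>\<^sub>0"
    unfolding of_real_in_nonpos_Ints_iff using x by auto
  have "complex_of_real (Gamma x * Gamma (x + 1/2)) =
        of_real (exp ((1 - 2*x) * ln 2) * sqrt pi * Gamma (2*x))"
    using Gamma_legendre_duplication[of "of_real x"] nonpos
    by (simp add: Gamma_complex_of_real [symmetric] exp_of_real [symmetric])
  hence "Gamma x * Gamma (x + 1/2) = exp ((1 - 2*x) * ln 2) * sqrt pi * Gamma (2*x)"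
    by (simp only: of_real_eq_iff)
  hence "ln (Gamma x * Gamma (x + 1/2)) = ln (exp ((1 - 2*x) * ln 2) * sqrt pi * Gamma (2*x))" by simp
  thus ?thesis
    using Gamma_real_pos[of x] Gamma_real_pos[of "x + 1/2"] Gamma_real_pos[of "2 * x"] x
    by (simp add: ln_mult ln_sqrt del: Gamma_real_pos)
qed

text \<open>
  A \<open>1\<close>-periodic function is determined by its behaviour at infinity. There the Stirling error minus
  the Binet integral has vanishing increments between arguments \<open>n\<close> and \<open>y + n\<close>, which makes it
  constant, and the duplication formula leaves \<open>0\<close> as the only possible constant.
\<close>

theorem binet_first_formula:
  assumes x: "x > 0"
  shows "binet_integral x = stirling_error x"
proof -
  define D where "D = (\<lambda>x. stirling_error x - binet_integral x)"
  have D_shift: "D (y + real n) = D y" if "y > 0" for y n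
  proof (induction n)
    case (Suc n)
    have "D (y + real n + 1) = D (y + real n)"
      using binet_integral_diff[of "y + real n"] stirling_error_diff[of "y + real n"] that
      by (simp add: D_def)
    thus ?case using Suc by (simp add: algebra_simps)
  qed simp
  have D_const: "D y = D 1" if y: "y > 0" for y
  proof -
    have "(\<lambda>n. (stirling_error (y + real (Suc n)) - stirling_error (real (Suc n)))
             - binet_integral (y + real (Suc n)) + binet_integral (real (Suc n))) \<longlonglongrightarrow> 0 - 0 + 0"
      by (intro tendsto_intros stirling_error_shift_tendsto_0 y filterlim_compose[OF binet_integral_tendsto_0])
         real_asymp+
    moreover have "(stirling_error (y + real (Suc n)) - stirling_error (real (Suc n)))
             - binet_integral (y + real (Suc n)) + binet_integral (real (Suc n)) = D y - D 1" for n
      using D_shift[OF y, of "Suc n"] D_shift[of 1 n] by (simp add: D_def algebra_simps)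
    ultimately have "(\<lambda>n::nat. D y - D 1) \<longlonglongrightarrow> 0" by simp
    thus ?thesis by (simp add: LIMSEQ_const_iff)
  qed
  have "((\<lambda>y. stirling_error y + stirling_error (y + 1/2) - stirling_error (2*y)) \<longlongrightarrow> 0) at_top"
  proof (rule Lim_transform_eventually)
    show "((\<lambda>y::real. (1 - 2*y) * ln 2 - ln 2 / 2 - (y - 1/2) * ln y - y * ln (y + 1/2)
             + (2*y - 1/2) * ln (2*y) + 1/2) \<longlongrightarrow> 0) at_top"
      by real_asymp
    show "eventually (\<lambda>y. (1 - 2*y) * ln 2 - ln 2 / 2 - (y - 1/2) * ln y - y * ln (y + 1/2)
             + (2*y - 1/2) * ln (2*y) + 1/2 =
             stirling_error y + stirling_error (y + 1/2) - stirling_error (2*y)) at_top"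
      using eventually_gt_at_top[of 0]
    proof eventually_elim
      case (elim y)
      have "ln (2 * pi) = ln 2 + ln pi" by (simp add: ln_mult)
      with ln_Gamma_duplication[OF elim] show ?case
        by (simp add: stirling_error_def algebra_simps add_divide_distrib)
    qed
  qed
  moreover have "((\<lambda>y. binet_integral (y + 1/2)) \<longlongrightarrow> 0) at_top"
    by (rule filterlim_compose[OF binet_integral_tendsto_0]) real_asymp
  moreover have "((\<lambda>y. binet_integral (2*y)) \<longlongrightarrow> 0) at_top"
    by (rule filterlim_compose[OF binet_integral_tendsto_0]) real_asymp
  ultimately have "((\<lambda>y. (stirling_error y + stirling_error (y + 1/2) - stirling_error (2*y))
           - binet_integral y - binet_integral (y + 1/2) + binet_integral (2*y)) \<longlongrightarrow> 0 - 0 - 0 + 0) at_top"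
    by (intro tendsto_add tendsto_diff binet_integral_tendsto_0)
  hence "((\<lambda>y. D y + D (y + 1/2) - D (2*y)) \<longlongrightarrow> 0) at_top"
    by (simp add: D_def algebra_simps)
  moreover have "eventually (\<lambda>y. D y + D (y + 1/2) - D (2*y) = D 1) at_top"
    using eventually_gt_at_top[of 0]
  proof eventually_elim
    case (elim y)
    thus ?case using D_const[of y] D_const[of "y + 1/2"] D_const[of "2*y"] by linarith
  qed
  ultimately have "((\<lambda>y::real. D 1) \<longlongrightarrow> 0) at_top"
    by (rule Lim_transform_eventually)
  hence "D 1 = 0" by (simp add: tendsto_const_iff)
  thus ?thesis using D_const[OF x] by (simp add: D_def)
qed

section \<open>The convergence criterion and the general formula\<close>

lemma scaled_binet_has_improper_integral:
  assumes a: "\<alpha> > 0" and x: "x > 0"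
  shows "(\<lambda>t. (\<alpha> / (exp (\<alpha> * t) - 1) - 1 / t + \<alpha> / 2) * (exp (- (t * x)) / t))
           has_improper_integral
             (\<alpha> * ln (Gamma (x / \<alpha>)) - (x - \<alpha> / 2) * ln (x / \<alpha>) + x - \<alpha> / 2 * ln (2 * pi))"
proof -
  let ?f = "\<lambda>t. (\<alpha> / (exp (\<alpha> * t) - 1) - 1 / t + \<alpha> / 2) * (exp (- (t * x)) / t)"
  let ?g = "\<lambda>u. indicator {0<..} u *\<^sub>R (binet_kernel u * exp (-(u * (x / \<alpha>))))"
  \<comment> \<open>One factor \<open>\<alpha>\<close> turns \<open>dt\<close> into \<open>du\<close> for \<open>u = \<alpha> * t\<close>, the other one multiplies the result.\<close>
  have eq: "indicator {0<..} t *\<^sub>R ?f t = \<alpha>\<^sup>2 * ?g (0 + \<alpha> * t)" for t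
    using a by (cases "t > 0")
      (auto simp: indicator_def binet_kernel_def zero_less_mult_iff field_simps power2_eq_square)
  have xa: "x / \<alpha> > 0" using a x by simp
  have g: "integrable lborel ?g" using set_integrable_binet[OF xa] by (simp add: set_integrable_def)
  have "integrable lborel (\<lambda>t. \<alpha>\<^sup>2 * ?g (0 + \<alpha> * t))"
    using a by (intro integrable_mult_right lborel_integrable_real_affine g) auto
  hence si: "set_integrable lborel {0<..} ?f"
    unfolding set_integrable_def eq .
  have "(LINT t:{0<..}|lborel. ?f t) = \<alpha>\<^sup>2 * (\<integral>t. ?g (0 + \<alpha> * t) \<partial>lborel)"
    unfolding set_lebesgue_integral_def eq by (rule integral_mult_right_zero)
  also have "\<dots> = \<alpha> * (\<alpha> * (\<integral>t. ?g (0 + \<alpha> * t) \<partial>lborel))" by (simp only: power2_eq_square mult.assoc)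
  also have "\<alpha> * (\<integral>t. ?g (0 + \<alpha> * t) \<partial>lborel) = (\<integral>u. ?g u \<partial>lborel)"
    using lborel_integral_real_affine[of \<alpha> ?g 0] a by simp
  also have "(\<integral>u. ?g u \<partial>lborel) = stirling_error (x / \<alpha>)"
    using binet_first_formula[OF xa] by (simp add: binet_integral_def set_lebesgue_integral_def)
  also have "\<alpha> * stirling_error (x / \<alpha>) =
      \<alpha> * ln (Gamma (x / \<alpha>)) - (x - \<alpha> / 2) * ln (x / \<alpha>) + x - \<alpha> / 2 * ln (2 * pi)"
  proof -
    have "\<alpha> * (x / \<alpha> - 1/2) = x - \<alpha> / 2" "\<alpha> * (x / \<alpha>) = x" using a by (simp_all add: field_simps)
    thus ?thesis unfolding stirling_error_def by (simp add: right_diff_distrib distrib_left flip: mult.assoc)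
  qed
  finally show ?thesis using has_improper_integral_of_set_integrable[OF si] by simp
qed

theorem theorem1:
  fixes a b \<alpha> x :: real
  assumes "b > a" and "\<alpha> > 0" and "x > 0"
  shows "(improper_integral_converges
            (\<lambda>t. ((b - a) / (exp ((b - a) * t) - 1) - 1 / t + b) * (exp (- (t * x)) / t))
          \<longleftrightarrow> a + b = 0) \<and>
         (\<lambda>t. (\<alpha> / (exp (\<alpha> * t) - 1) - 1 / t + \<alpha> / 2) * (exp (- (t * x)) / t))
           has_improper_integral
             (\<alpha> * ln (Gamma (x / \<alpha>)) - (x - \<alpha> / 2) * ln (x / \<alpha>) + x - \<alpha> / 2 * ln (2 * pi))"
proof
  let ?f = "\<lambda>t. ((b - a) / (exp ((b - a) * t) - 1) - 1 / t + b) * (exp (- (t * x)) / t)"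
  let ?g = "\<lambda>t. ((b - a) / (exp ((b - a) * t) - 1) - 1 / t + (b - a) / 2) * (exp (- (t * x)) / t)"
  have ba: "b - a > 0" using assms by simp
  obtain J where g: "?g has_improper_integral J"
    by (rule that[OF scaled_binet_has_improper_integral[OF ba assms(3)]])
  show "improper_integral_converges ?f \<longleftrightarrow> a + b = 0"
  proof
    assume "a + b = 0"
    hence "(b - a) / 2 = b" by simp
    with g have "?f has_improper_integral J" by (simp only:)
    thus "improper_integral_converges ?f"
      unfolding improper_integral_converges_def by (rule exI)
  next
    assume "improper_integral_converges ?f"
    then obtain I where f: "?f has_improper_integral I"
      unfolding improper_integral_converges_def by blast
    show "a + b = 0"
    proof (rule ccontr)
      assume ne: "a + b \<noteq> 0"
      have "(\<lambda>t. 2 / (a + b) * (?f t - ?g t)) has_improper_integral (2 / (a + b) * (I - J))"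
        by (intro has_improper_integral_cmult has_improper_integral_diff f g)
      moreover have "2 / (a + b) * (?f t - ?g t) = exp (- (t * x)) / t" for t
      proof -
        have "(p + b) * q - (p + (b - a) / 2) * q = (a + b) / 2 * q" for p q :: real
          by (simp add: field_simps)
        hence "?f t - ?g t = (a + b) / 2 * (exp (- (t * x)) / t)" .
        thus ?thesis using ne by (simp only:) simp
      qed
      ultimately have "(\<lambda>t. exp (- (t * x)) / t) has_improper_integral (2 / (a + b) * (I - J))"
        by (simp only:)
      thus False
        using not_improper_integral_converges_exp_over_t[OF assms(3)]
        unfolding improper_integral_converges_def by blast
    qed
  qed
qed (rule scaled_binet_has_improper_integral[OF assms(2,3)])

end
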